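(* Let $0<\delta<\tfrac12$. Consider the following online algorithm for the Online Simple Knapsack problem with item size estimates and additive accuracy $\delta$: if the largest announced (estimated) size $b'$ among all items satisfies $b'\ge 0.5$, the algorithm rejects every item except one item $b$ with this largest announced size, which it packs when it arrives; otherwise it packs items greedily (each arriving item is packed if and only if it fits into the remaining capacity). This algorithm has competitive ratio at most $\frac{2}{1-2\delta}$.
   Context: Online Simple Knapsack with Item Size Estimates (additive accuracy $\delta\ge 0$): an instance consists of actual item sizes $x_1,\dots,x_n\in[0,1]$ together with estimated sizes $x_1',\dots,x_n'$ satisfying $x_i'-\delta\le x_i\le x_i'+\delta$ for all $i$. A deterministic online algorithm knows $\delta$ and the whole list of estimates from the start. The actual sizes are then revealed one at a time in order. When $x_i$ is revealed, the algorithm must irrevocably either pack it into an initially empty knapsack of capacity $1$ (allowed only if the total size already packed plus $x_i$ is at most $1$) or reject it. The gain of an algorithm is the total size of the packed items; $\mathrm{OPT}$ is the maximum total size of a subset of the actual items with total at most $1$. The competitive ratio of an algorithm $A$ is $\sup \mathrm{OPT}/\mathrm{gain}_A$ over all instances with accuracy $\delta$. *)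

theory Defs
  imports "HOL-Library.Extended_Real"
begin

text \<open>
  An instance is a list of estimated sizes together with an equally long list of actual
  sizes, the latter in order of arrival.
\<close>

definition knapsack_instance :: "real \<Rightarrow> real list \<Rightarrow> real list \<Rightarrow> bool" where
  "knapsack_instance \<delta> est xs \<longleftrightarrow>
     length xs = length est \<and>
     (\<forall>i<length xs. 0 \<le> xs ! i \<and> xs ! i \<le> 1 \<and>
        est ! i - \<delta> \<le> xs ! i \<and> xs ! i \<le> est ! i + \<delta>)"

text \<open>
  A deterministic online algorithm maps the list of all estimates, the history (actual sizes
  of the earlier items, each with the decision taken) and the size of the arriving item to the
  decision whether to pack that item. The accuracy is a known constant, so it is not an
  argument: an algorithm may be chosen depending on it.
\<close>

type_synonym online_algorithm = "real list \<Rightarrow> (real \<times> bool) list \<Rightarrow> real \<Rightarrow> bool"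

definition load :: "(real \<times> bool) list \<Rightarrow> real" where
  "load hist = (\<Sum>(x, packed)\<leftarrow>hist. if packed then x else 0)"

primrec run_from ::
    "online_algorithm \<Rightarrow> real list \<Rightarrow> (real \<times> bool) list \<Rightarrow> real list \<Rightarrow> (real \<times> bool) list" where
  "run_from A est hist [] = hist"
| "run_from A est hist (x # xs) = run_from A est (hist @ [(x, A est hist x)]) xs"

definition run :: "online_algorithm \<Rightarrow> real list \<Rightarrow> real list \<Rightarrow> (real \<times> bool) list" where
  "run A est xs = run_from A est [] xs"

definition gain :: "online_algorithm \<Rightarrow> real list \<Rightarrow> real list \<Rightarrow> real" where
  "gain A est xs = load (run A est xs)"

text \<open>Every packed item fits into the remaining capacity at the moment it is packed.\<close>

definition respects_capacity :: "real \<Rightarrow> online_algorithm \<Rightarrow> bool" where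
  "respects_capacity \<delta> A \<longleftrightarrow>
     (\<forall>est xs. knapsack_instance \<delta> est xs \<longrightarrow>
        (\<forall>i<length xs. A est (run A est (take i xs)) (xs ! i) \<longrightarrow>
           load (run A est (take i xs)) + xs ! i \<le> 1))"

definition opt :: "real list \<Rightarrow> real" where
  "opt xs = Max ((\<lambda>S. \<Sum>i\<in>S. xs ! i) ` {S. S \<subseteq> {..<length xs} \<and> (\<Sum>i\<in>S. xs ! i) \<le> 1})"

text \<open>
  The quotient is taken in the extended reals: it is \<open>\<infinity>\<close> if the gain is 0 and the optimum is
  positive, and \<open>0 / 0 = 0\<close>, so instances with optimum 0 do not affect the supremum.
\<close>

definition competitive_ratio :: "real \<Rightarrow> online_algorithm \<Rightarrow> ereal" where
  "competitive_ratio \<delta> A =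
     (SUP (est, xs) \<in> {(est, xs). knapsack_instance \<delta> est xs}.
        ereal (opt xs) / ereal (gain A est xs))"

text \<open>A rule selecting (the index of) one item of largest announced size; ties are broken arbitrarily.\<close>

definition selects_largest :: "(real list \<Rightarrow> nat) \<Rightarrow> bool" where
  "selects_largest sel \<longleftrightarrow>
     (\<forall>est. est \<noteq> [] \<longrightarrow> sel est < length est \<and> est ! sel est = Max (set est))"

text \<open>The length of the history is the (zero-based) index of the arriving item.\<close>

definition largest_or_greedy :: "(real list \<Rightarrow> nat) \<Rightarrow> online_algorithm" where
  "largest_or_greedy sel est hist x \<longleftrightarrow>
     (if est \<noteq> [] \<and> Max (set est) \<ge> 1/2
      then length hist = sel est
      else load hist + x \<le> 1)"

end

theory Submission
  imports Defs
begin

text \<open>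
  Since \<open>OPT \<le> 1\<close>, a gain of at least \<open>1/2 - \<delta>\<close> suffices. If an item is announced with size at
  least \<open>1/2\<close>, the single packed item is that large. Otherwise every item has actual size below
  \<open>1/2 + \<delta>\<close>, so as soon as the greedy rule rejects an item its load exceeds \<open>1/2 - \<delta>\<close>; and if it
  never rejects one, it is optimal.
\<close>

lemma load_snoc [simp]: "load (hist @ [(x, b)]) = load hist + (if b then x else 0)"
  by (simp add: load_def)

lemma run_Nil [simp]: "run A est [] = []"
  by (simp add: run_def)

text \<open>\<open>run_from\<close> recurses from the front, but the load is tracked in order of
  arrival. Peeling off the last item makes \<open>rev_induct\<close> follow the online
  process.\<close>

lemma run_snoc: "run A est (xs @ [x]) = run A est xs @ [(x, A est (run A est xs) x)]"
proof -
  have "run_from A est hist (xs @ [x]) =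
      run_from A est hist xs @ [(x, A est (run_from A est hist xs) x)]" for hist
    by (induction xs arbitrary: hist) auto
  then show ?thesis by (simp add: run_def)
qed

lemma length_run [simp]: "length (run A est xs) = length xs"
  by (induction xs rule: rev_induct) (auto simp: run_snoc)

text \<open>The lengths of \<open>est\<close> and \<open>xs\<close> are left unrelated so that this
  also applies to prefixes of an instance, in particular to those ending before the selected item
  arrives.\<close>

lemma gain_largest:
  assumes "est \<noteq> []" "Max (set est) \<ge> 1/2"
  shows "gain (largest_or_greedy sel) est xs = (if sel est < length xs then xs ! sel est else 0)"
proof (induction xs rule: rev_induct)
  case Nil
  then show ?case by (simp add: gain_def load_def)
next
  case (snoc x xs)
  then show ?case using assms
    by (auto simp: gain_def run_snoc largest_or_greedy_def nth_append)
qed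

text \<open>A rejected item is itself a witness of overflow when it arrives. Sizes are nonnegative,
  so the load never decreases and the witness stays valid.\<close>

lemma gain_greedy:
  assumes "\<not> (est \<noteq> [] \<and> Max (set est) \<ge> 1/2)" "\<forall>x\<in>set xs. 0 \<le> x"
  shows "gain (largest_or_greedy sel) est xs = sum_list xs \<or>
         (\<exists>x\<in>set xs. gain (largest_or_greedy sel) est xs + x > 1)"
  using assms(2)
proof (induction xs rule: rev_induct)
  case Nil
  then show ?case by (simp add: gain_def load_def)
next
  case (snoc x xs)
  have decision: "largest_or_greedy sel est hist x \<longleftrightarrow> load hist + x \<le> 1" for hist
    unfolding largest_or_greedy_def using assms(1) by auto
  have "gain (largest_or_greedy sel) est (xs @ [x]) = gain (largest_or_greedy sel) est xs
      + (if gain (largest_or_greedy sel) est xs + x \<le> 1 then x else 0)"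
    by (simp add: gain_def run_snoc decision)
  with snoc show ?case by force
qed

lemma respects_capacity_largest_or_greedy: "respects_capacity \<delta> (largest_or_greedy sel)"
  unfolding respects_capacity_def
proof (intro allI impI)
  fix est xs i
  let ?A = "largest_or_greedy sel"
  assume inst: "knapsack_instance \<delta> est xs" and i: "i < length xs"
    and pack: "?A est (run ?A est (take i xs)) (xs ! i)"
  show "load (run ?A est (take i xs)) + xs ! i \<le> 1"
  proof (cases "est \<noteq> [] \<and> Max (set est) \<ge> 1/2")
    case True
    then have "sel est = i"
      using pack i by (simp add: largest_or_greedy_def)
    \<comment> \<open>The prefix has length \<open>i\<close>, so it stops just before the selected
      index; the knapsack is still empty, and a single item has size at most 1.\<close>
    then have "load (run ?A est (take i xs)) = 0"
      using gain_largest[of est sel "take i xs"] True by (simp add: gain_def)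
    then show ?thesis
      using inst i by (simp add: knapsack_instance_def)
  next
    case False
    then show ?thesis
      using pack unfolding largest_or_greedy_def by (simp only: if_False)
  qed
qed

lemma opt_bounds:
  assumes "\<forall>x\<in>set xs. 0 \<le> x"
  shows "0 \<le> opt xs" "opt xs \<le> 1" "opt xs \<le> sum_list xs"
proof -
  let ?P = "{S. S \<subseteq> {..<length xs} \<and> (\<Sum>i\<in>S. xs ! i) \<le> 1}"
  have fin: "finite ((\<lambda>S. \<Sum>i\<in>S. xs ! i) ` ?P)"
    by (auto intro: finite_subset[of _ "Pow {..<length xs}"])
  \<comment> \<open>The empty selection is feasible: this makes \<open>Max\<close> meaningful and
    bounds it below by 0.\<close>
  have empty: "0 \<in> (\<lambda>S. \<Sum>i\<in>S. xs ! i) ` ?P"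
    by (rule image_eqI[of _ _ "{}"]) auto
  show "0 \<le> opt xs"
    unfolding opt_def using fin empty by (rule Max_ge)
  have "opt xs \<in> (\<lambda>S. \<Sum>i\<in>S. xs ! i) ` ?P"
    unfolding opt_def using fin empty by (intro Max_in) auto
  then obtain S where S: "S \<subseteq> {..<length xs}" "(\<Sum>i\<in>S. xs ! i) \<le> 1"
      "opt xs = (\<Sum>i\<in>S. xs ! i)"
    by auto
  then show "opt xs \<le> 1" by simp
  have "(\<Sum>i\<in>S. xs ! i) \<le> (\<Sum>i<length xs. xs ! i)"
    using S(1) assms by (intro sum_mono2) auto
  then show "opt xs \<le> sum_list xs"
    using S(3) by (simp add: sum_list_sum_nth atLeast0LessThan)
qed

text \<open>The product form of the hypothesis covers gain 0: then \<open>a\<close> is 0 as well,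
  and 0 / 0 = 0 in \<open>ereal\<close>.\<close>

lemma ereal_divide_le:
  fixes a b c :: real
  assumes "0 \<le> a" "0 \<le> b" "a \<le> c * b" "0 \<le> c"
  shows "ereal a / ereal b \<le> ereal c"
proof (cases "b = 0")
  case True
  then have "a = 0" using assms by simp
  then show ?thesis using assms by (simp add: zero_ereal_def[symmetric])
next
  case False
  then show ?thesis using assms by (simp add: divide_le_eq)
qed

lemma opt_le_gain:
  assumes "0 \<le> \<delta>" "\<delta> < 1/2" "selects_largest sel" and inst: "knapsack_instance \<delta> est xs"
  shows "(1/2 - \<delta>) * opt xs \<le> gain (largest_or_greedy sel) est xs"
proof -
  let ?g = "gain (largest_or_greedy sel) est xs"
  have nonneg: "\<forall>x\<in>set xs. 0 \<le> x"
    using inst by (auto simp: knapsack_instance_def in_set_conv_nth)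
  note opt = opt_bounds[OF nonneg]
  have suff: "(1/2 - \<delta>) * opt xs \<le> ?g" if "1/2 - \<delta> \<le> ?g"
    using mult_left_le[of "opt xs" "1/2 - \<delta>"] opt(2) assms(2) that by linarith
  show ?thesis
  proof (cases "est \<noteq> [] \<and> Max (set est) \<ge> 1/2")
    case True
    then have "sel est < length est" "est ! sel est \<ge> 1/2"
      using assms(3) by (auto simp: selects_largest_def)
    then have "1/2 - \<delta> \<le> ?g"
      using True inst by (force simp: gain_largest knapsack_instance_def)
    then show ?thesis by (rule suff)
  next
    case False
    from gain_greedy[OF False nonneg, of sel] show ?thesis
    proof
      assume "?g = sum_list xs"
      moreover have "(1/2 - \<delta>) * opt xs \<le> 1 * opt xs"
        using assms(1) opt(1) by (intro mult_right_mono) auto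
      ultimately show ?thesis using opt(3) by linarith
    next
      assume "\<exists>x\<in>set xs. ?g + x > 1"
      then obtain i where i: "i < length xs" "?g + xs ! i > 1"
        by (auto simp: in_set_conv_nth)
      then have "est ! i \<in> set est"
        using inst by (simp add: knapsack_instance_def)
      \<comment> \<open>The estimate of the overflowing item is at most the maximum, which is below
        1/2 here. Its actual size is thus below 1/2 + \<delta>, which forces \<open>?g\<close> above
        1/2 - \<delta>.\<close>
      then have "est ! i < 1/2"
        using False by (metis List.finite_set Max_ge empty_iff empty_set not_le order_trans)
      moreover have "xs ! i \<le> est ! i + \<delta>"
        using inst i by (simp add: knapsack_instance_def)
      ultimately show ?thesis using i(2) by (intro suff) linarith
    qed
  qed
qed

theorem theorem8:
  fixes \<delta> :: real and sel :: "real list \<Rightarrow> nat"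
  assumes "0 < \<delta>" and "\<delta> < 1/2"
    and "selects_largest sel"
  shows "respects_capacity \<delta> (largest_or_greedy sel) \<and>
         competitive_ratio \<delta> (largest_or_greedy sel) \<le> ereal (2 / (1 - 2 * \<delta>))"
proof
  show "competitive_ratio \<delta> (largest_or_greedy sel) \<le> ereal (2 / (1 - 2 * \<delta>))"
    unfolding competitive_ratio_def
  proof (rule SUP_least, clarify)
    fix est xs
    assume inst: "knapsack_instance \<delta> est xs"
    let ?g = "gain (largest_or_greedy sel) est xs"
    have le: "(1/2 - \<delta>) * opt xs \<le> ?g"
      using assms inst by (intro opt_le_gain) auto
    have "0 \<le> opt xs"
      using inst by (intro opt_bounds) (auto simp: knapsack_instance_def in_set_conv_nth)
    moreover from this have "0 \<le> (1/2 - \<delta>) * opt xs"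
      using assms(2) by simp
    with le have "0 \<le> ?g" by linarith
    \<comment> \<open>The claimed ratio is the reciprocal of 1/2 - \<delta>, which is
      positive.\<close>
    moreover have "opt xs \<le> 2 / (1 - 2 * \<delta>) * ?g"
      using le assms(2) by (simp add: field_simps)
    ultimately show "ereal (opt xs) / ereal ?g \<le> ereal (2 / (1 - 2 * \<delta>))"
      using assms(2) by (intro ereal_divide_le) auto
  qed
qed (rule respects_capacity_largest_or_greedy)

end
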